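(* Let $K$ be an infinite commutative field with $\operatorname{Char}K\neq3$. Let $F\subset\mathbb{P}_3(K)$ be the Cayley surface $F=\mathcal{V}(X_0X_1X_2-X_1^3-X_0^2X_3)$, let $g_\infty=\mathcal{V}(X_0,X_1)$, and let $\mathcal{O}$ be the set of lines of $\mathbb{P}_3(K)$ consisting of all proper osculating tangents of $F$ together with $g_\infty$. Let $\mathcal{L}[Z,\omega]$ be the pencil of all lines that lie in the plane $\omega=\mathcal{V}(X_0)$ and pass through the point $Z=K(0,0,0,1)^T$, and let $\kappa$ be the Klein mapping. If $h(\mathbf{Y})\in K[\mathbf{Y}]$, $\mathbf{Y}=(Y_{01},Y_{02},Y_{03},Y_{12},Y_{13},Y_{23})$, is a form (homogeneous polynomial) such that $\kappa(\mathcal{O})\subset\mathcal{V}(h(\mathbf{Y}))$, then $\kappa(\mathcal{L}[Z,\omega])\subset\mathcal{V}(h(\mathbf{Y}))$.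
   Context: Points of the projective space $\mathbb{P}_3(K)$ are the one-dimensional subspaces $K\mathbf{p}$ with $0\neq\mathbf{p}=(p_0,p_1,p_2,p_3)^{T}\in K^{4\times1}$; similarly for $\mathbb{P}_5(K)$ with $K^{6\times 1}$. For homogeneous polynomials $g_1,\dots,g_r$ over $K$, $\mathcal{V}(g_1,\dots,g_r)$ denotes the set of ($K$-rational) points at which $g_1,\dots,g_r$ all vanish, in $\mathbb{P}_3(K)$ for polynomials in $X_0,\dots,X_3$ and in $\mathbb{P}_5(K)$ for polynomials in $\mathbf{Y}$. Put $f:=X_0X_1X_2-X_1^3-X_0^2X_3$, so $F=\mathcal{V}(f)$. A point of $F$ is simple if not all the partial derivatives $\partial f/\partial X_i$ vanish there. The simple points of $F$ are exactly the points of $F$ outside $\omega$, namely $P(u_1,u_2)=K(1,u_1,u_2,u_1u_2-u_1^3)^T$ with $(u_1,u_2)\in K^2$. A generator of $F$ is one of the lines spanned by $K(s_0^2,s_0s_1,s_1^2,0)^T$ and $K(0,0,s_0,s_1)^T$, with $(s_0,s_1)\in K^2\setminus\{(0,0)\}$; these are the lines contained in $F$. A line $t$ is an osculating tangent of $F$ at a simple point $P=K\mathbf{p}$ if it meets $F$ at $P$ with multiplicity $\geq 3$: for $t=K\mathbf{p}+K\mathbf{q}$ the polynomial $f(\mathbf{p}+T\mathbf{q})\in K[T]$ is divisible by $T^3$ (possibly zero). A proper osculating tangent of $F$ is an osculating tangent at some simple point that is not a generator of $F$. The Klein mapping $\kappa$ sends a line $K\mathbf{p}+K\mathbf{q}$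 of $\mathbb{P}_3(K)$ to the point $K(y_{01},y_{02},y_{03},y_{12},y_{13},y_{23})^T$ of $\mathbb{P}_5(K)$, where $y_{ij}=p_iq_j-p_jq_i$ (Plücker coordinates); it is a bijection from the set of lines of $\mathbb{P}_3(K)$ onto the Klein quadric $Q=\mathcal{V}(Y_{01}Y_{23}-Y_{02}Y_{13}+Y_{03}Y_{12})$. *)

theory Defs
  imports "HOL-Analysis.Analysis" "HOL-Library.Poly_Mapping"
begin

text \<open>
  Polynomials over \<open>'a\<close> in the variables indexed by the finite type \<open>'n\<close>; a monomial is given by
  its vector of exponents.  The index types \<open>4\<close> and \<open>6\<close> consist of the numerals \<open>0,\<dots>,3\<close> and
  \<open>0,\<dots>,5\<close>, so that coordinates are numbered from \<open>0\<close>.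
\<close>

type_synonym ('n, 'a) mpol = "('n \<Rightarrow>\<^sub>0 nat) \<Rightarrow>\<^sub>0 'a"

definition X :: "'n::finite \<Rightarrow> ('n, 'a::comm_ring_1) mpol" where
  "X i = Poly_Mapping.single (Poly_Mapping.single i 1) 1"

text \<open>The value of \<open>g\<close> at \<open>x\<close>, the coefficients being mapped into the target ring by \<open>\<phi>\<close>.\<close>

definition mp_subst :: "('a::comm_ring_1 \<Rightarrow> 'b::comm_ring_1) \<Rightarrow> ('n::finite \<Rightarrow> 'b) \<Rightarrow> ('n, 'a) mpol \<Rightarrow> 'b" where
  "mp_subst \<phi> x g = (\<Sum>m\<in>Poly_Mapping.keys g.
     \<phi> (Poly_Mapping.lookup g m) * (\<Prod>i\<in>UNIV. x i ^ Poly_Mapping.lookup m i))"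

definition mp_eval :: "('n::finite, 'a::comm_ring_1) mpol \<Rightarrow> 'a ^ 'n \<Rightarrow> 'a" where
  "mp_eval g x = mp_subst (\<lambda>c. c) (\<lambda>i. x $ i) g"

definition mp_partial :: "'n::finite \<Rightarrow> ('n, 'a::comm_ring_1) mpol \<Rightarrow> ('n, 'a) mpol" where
  "mp_partial i g = (\<Sum>m\<in>Poly_Mapping.keys g.
     Poly_Mapping.single (m - Poly_Mapping.single i 1)
       (of_nat (Poly_Mapping.lookup m i) * Poly_Mapping.lookup g m))"

text \<open>The zero polynomial is a form (of every degree).\<close>

definition is_form :: "('n::finite, 'a::comm_ring_1) mpol \<Rightarrow> bool" where
  "is_form g \<longleftrightarrow> (\<exists>d. \<forall>m\<in>Poly_Mapping.keys g. (\<Sum>i\<in>UNIV. Poly_Mapping.lookup m i) = d)"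

definition points :: "('a::field ^ 'n) set set" where
  "points = {vec.span {p} | p. p \<noteq> 0}"

definition \<V> :: "('n::finite, 'a::field) mpol set \<Rightarrow> ('a ^ 'n) set set" where
  "\<V> G = {P \<in> points. \<forall>g\<in>G. \<forall>p\<in>P. p \<noteq> 0 \<longrightarrow> mp_eval g p = 0}"

text \<open>
  A line is treated as the set of its points; \<open>join p q\<close> is the line \<open>Kp + Kq\<close> whenever
  \<open>p\<close> and \<open>q\<close> are linearly independent.
\<close>

definition lin_indep :: "'a::field ^ 'n \<Rightarrow> 'a ^ 'n \<Rightarrow> bool" where
  "lin_indep p q \<longleftrightarrow> p \<noteq> q \<and> vec.independent {p, q}"

definition join :: "'a::field ^ 'n \<Rightarrow> 'a ^ 'n \<Rightarrow> ('a ^ 'n) set set" where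
  "join p q = {P \<in> points. P \<subseteq> vec.span {p, q}}"

definition lines :: "('a::field ^ 'n) set set set" where
  "lines = {join p q | p q. lin_indep p q}"

definition vec4 :: "'a \<Rightarrow> 'a \<Rightarrow> 'a \<Rightarrow> 'a \<Rightarrow> 'a ^ 4" where
  "vec4 a b c d = (\<chi> i. if i = 0 then a else if i = 1 then b else if i = 2 then c else d)"

definition vec6 :: "'a \<Rightarrow> 'a \<Rightarrow> 'a \<Rightarrow> 'a \<Rightarrow> 'a \<Rightarrow> 'a \<Rightarrow> 'a ^ 6" where
  "vec6 a b c d e f = (\<chi> i. if i = 0 then a else if i = 1 then b else if i = 2 then c
     else if i = 3 then d else if i = 4 then e else f)"

definition pluecker :: "'a::field ^ 4 \<Rightarrow> 'a ^ 4 \<Rightarrow> 'a ^ 6" where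
  "pluecker p q = (let y = (\<lambda>i j. p $ i * q $ j - p $ j * q $ i)
     in vec6 (y 0 1) (y 0 2) (y 0 3) (y 1 2) (y 1 3) (y 2 3))"

text \<open>Meaningful for lines only, where the choice of \<open>p\<close> and \<open>q\<close> is immaterial (\<open>klein_join\<close>).\<close>

definition klein :: "('a::field ^ 4) set set \<Rightarrow> ('a ^ 6) set" where
  "klein t = (THE P. \<exists>p q. lin_indep p q \<and> t = join p q \<and> P = vec.span {pluecker p q})"

lemma span_join:
  fixes p q :: "'a::field ^ 'n"
  shows "vec.span {p, q} = insert 0 (\<Union>(join p q))"
proof
  show "vec.span {p, q} \<subseteq> insert 0 (\<Union>(join p q))"
  proof
    fix x assume x: "x \<in> vec.span {p, q}"
    show "x \<in> insert 0 (\<Union>(join p q))"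
    proof (cases "x = 0")
      case False
      have "vec.span {x} \<subseteq> vec.span {p, q}"
        using x by (simp add: vec.span_minimal vec.subspace_span)
      with False have "vec.span {x} \<in> join p q" by (auto simp: join_def points_def)
      thus ?thesis using vec.span_base[of x "{x}"] by blast
    qed simp
  qed
qed (auto simp: join_def vec.span_zero)

lemma pluecker_in_span:
  fixes p q :: "'a::field ^ 4"
  assumes "p' \<in> vec.span {p, q}" "q' \<in> vec.span {p, q}"
  shows "pluecker p' q' \<in> vec.span {pluecker p q}"
proof -
  have "\<exists>a b. x = a *s p + b *s q" if "x \<in> vec.span {p, q}" for x
  proof -
    from that obtain a where "x - a *s p \<in> vec.span {q}"
      by (auto simp: vec.span_insert)
    then obtain b where "x - a *s p = b *s q" by (auto simp: vec.span_singleton)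
    hence "x = a *s p + b *s q" by (simp add: algebra_simps)
    thus ?thesis by blast
  qed
  then obtain a b c d where
    "p' = a *s p + b *s q" "q' = c *s p + d *s q" using assms by metis
  hence "pluecker p' q' = (a * d - b * c) *s pluecker p q"
    by (simp add: pluecker_def vec6_def vec_eq_iff Let_def algebra_simps)
  thus ?thesis by (metis vec.span_base vec.span_scale insertI1)
qed

lemma klein_join:
  fixes p q :: "'a::field ^ 4"
  assumes "lin_indep p q"
  shows "klein (join p q) = vec.span {pluecker p q}"
  unfolding klein_def
proof (rule the_equality)
  fix P assume "\<exists>p' q'. lin_indep p' q' \<and> join p q = join p' q' \<and> P = vec.span {pluecker p' q'}"
  then obtain p' q' where *: "join p q = join p' q'" "P = vec.span {pluecker p' q'}" by blast
  have eq: "vec.span {p, q} = vec.span {p', q'}" by (simp add: span_join * )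
  have "pluecker p q \<in> vec.span {pluecker p' q'}"
    by (rule pluecker_in_span) (simp_all add: eq[symmetric] vec.span_base)
  moreover have "pluecker p' q' \<in> vec.span {pluecker p q}"
    by (rule pluecker_in_span) (simp_all add: eq vec.span_base)
  ultimately show "P = vec.span {pluecker p q}"
    unfolding * by (intro subset_antisym vec.span_minimal vec.subspace_span) auto
qed (use assms in blast)

definition cayley_f :: "(4, 'a::field) mpol" where
  "cayley_f = X 0 * X 1 * X 2 - X 1 ^ 3 - X 0 ^ 2 * X 3"

definition cayley_surface :: "('a::field ^ 4) set set" where
  "cayley_surface = \<V> {cayley_f}"

definition simple_points :: "('a::field ^ 4) set set" where
  "simple_points = {P \<in> cayley_surface. P \<notin> \<V> (range (\<lambda>i. mp_partial i cayley_f))}"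

definition generators :: "('a::field ^ 4) set set set" where
  "generators = {join (vec4 (s0^2) (s0 * s1) (s1^2) 0) (vec4 0 0 s0 s1) | s0 s1. (s0, s1) \<noteq> (0, 0)}"

text \<open>
  The polynomial \<open>f(p + Tq)\<close> is formed by substituting the linear polynomials \<open>p\<^sub>i + q\<^sub>i T\<close>.
  Divisibility of it by \<open>T\<^sup>3\<close> depends only on \<open>Kp\<close> and \<open>Kp + Kq\<close>.
\<close>

definition osculating_at :: "('a::field ^ 4) set set \<Rightarrow> ('a ^ 4) set \<Rightarrow> bool" where
  "osculating_at t P \<longleftrightarrow> (\<exists>p q. lin_indep p q \<and> P = vec.span {p} \<and> t = join p q \<and>
     [:0, 1:] ^ 3 dvd mp_subst (\<lambda>c. [:c:]) (\<lambda>i. [:p $ i, q $ i:]) cayley_f)"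

definition proper_osculating_tangents :: "('a::field ^ 4) set set set" where
  "proper_osculating_tangents = {t. (\<exists>P\<in>simple_points. osculating_at t P) \<and> t \<notin> generators}"

definition g_inf :: "('a::field ^ 4) set set" where
  "g_inf = \<V> {X 0, X 1}"

definition osculating_family :: "('a::field ^ 4) set set set" where
  "osculating_family = insert g_inf proper_osculating_tangents"

definition \<omega> :: "('a::field ^ 4) set set" where
  "\<omega> = \<V> {X 0}"

definition Z :: "('a::field ^ 4) set" where
  "Z = vec.span {vec4 0 0 0 1}"

definition pencil :: "('a::field ^ 4) set \<Rightarrow> ('a ^ 4) set set \<Rightarrow> ('a ^ 4) set set set" where
  "pencil P \<pi> = {t \<in> lines. t \<subseteq> \<pi> \<and> P \<in> t}"

end

theory Submission
  imports Defs
begin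

text \<open>
  The osculating tangent at \<open>P(t, v t\<^sup>2)\<close> has Pluecker coordinates
  \<open>(1, 3 t, v t\<^sup>2, (3 - v) t\<^sup>2, t\<^sup>3, N(v) t\<^sup>4)\<close> with \<open>N(v) = v\<^sup>2 - 3 v + 3\<close>. Let \<open>h\<close> be a form of
  degree \<open>d\<close> vanishing there for all \<open>t\<close> and \<open>v\<close>. A monomial with exponent \<open>k\<close> at \<open>Y\<^sub>2\<^sub>3\<close>
  contributes \<open>t\<close>-degree at most \<open>3 d + k\<close>, with equality only for \<open>Y\<^sub>1\<^sub>3\<^sup>d\<^sup>-\<^sup>k Y\<^sub>2\<^sub>3\<^sup>k\<close>. Hence the
  coefficient of \<open>t\<^sup>3\<^sup>d\<^sup>+\<^sup>k\<close> is \<open>N\<^sup>k\<close> times the coefficient of that monomial in \<open>h\<close>, plus a multiple of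
  \<open>N\<^sup>k\<^sup>+\<^sup>1\<close>. As this vanishes and \<open>N\<close> is not constant, \<open>h\<close> contains none of the monomials
  \<open>Y\<^sub>1\<^sub>3\<^sup>d\<^sup>-\<^sup>k Y\<^sub>2\<^sub>3\<^sup>k\<close>, so it vanishes wherever the other four coordinates do.
\<close>

section \<open>Coordinates numbered from 0\<close>

lemma UNIV_6: "(UNIV :: 6 set) = {0, 1, 2, 3, 4, 5}"
proof -
  have "card {0, 1, 2, 3, 4, 5 :: 6} = 6" by simp
  hence "card {0, 1, 2, 3, 4, 5 :: 6} = CARD(6)" by simp
  thus ?thesis by (metis card_subset_eq finite subset_UNIV)
qed

lemma UNIV_4_from_0: "(UNIV :: 4 set) = {0, 1, 2, 3}"
proof -
  have "card {0, 1, 2, 3 :: 4} = CARD(4)" by simp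
  thus ?thesis by (metis card_subset_eq finite subset_UNIV)
qed

lemma forall_4_from_0: "(\<forall>i :: 4. P i) \<longleftrightarrow> P 0 \<and> P 1 \<and> P 2 \<and> P 3"
proof -
  have "(\<forall>i :: 4. P i) \<longleftrightarrow> (\<forall>i\<in>{0, 1, 2, 3}. P i)"
    using UNIV_4_from_0 by (metis UNIV_I)
  thus ?thesis by simp
qed

lemma forall_6_from_0: "(\<forall>i :: 6. P i) \<longleftrightarrow> P 0 \<and> P 1 \<and> P 2 \<and> P 3 \<and> P 4 \<and> P 5"
proof -
  have "(\<forall>i :: 6. P i) \<longleftrightarrow> (\<forall>i\<in>{0, 1, 2, 3, 4, 5}. P i)"
    using UNIV_6 by (metis UNIV_I)
  thus ?thesis by simp
qed

lemma prod_4_from_0: "prod f (UNIV :: 4 set) = f 0 * (f 1 * (f 2 * f 3))"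
  unfolding UNIV_4_from_0 by simp

lemma prod_6: "prod f (UNIV :: 6 set) = f 0 * (f 1 * (f 2 * (f 3 * (f 4 * f 5))))"
  unfolding UNIV_6 by simp

lemma sum_6: "sum f (UNIV :: 6 set) = f 0 + (f 1 + (f 2 + (f 3 + (f 4 + f 5))))"
  unfolding UNIV_6 by simp

lemma vec4_nth [simp]:
  "vec4 a b c d $ 0 = a" "vec4 a b c d $ 1 = b" "vec4 a b c d $ 2 = c" "vec4 a b c d $ 3 = d"
  by (simp_all add: vec4_def)

lemma vec6_nth [simp]:
  "vec6 a b c d e f $ 0 = a" "vec6 a b c d e f $ 1 = b" "vec6 a b c d e f $ 2 = c"
  "vec6 a b c d e f $ 3 = d" "vec6 a b c d e f $ 4 = e" "vec6 a b c d e f $ 5 = f"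
  by (simp_all add: vec6_def)

section \<open>Substitution into polynomials and partial derivatives\<close>

lemma mp_subst_superset:
  assumes "finite S" "Poly_Mapping.keys g \<subseteq> S" "\<phi> 0 = 0"
  shows "mp_subst \<phi> x g = (\<Sum>m\<in>S. \<phi> (Poly_Mapping.lookup g m) * (\<Prod>i\<in>UNIV. x i ^ Poly_Mapping.lookup m i))"
  unfolding mp_subst_def
  by (rule sum.mono_neutral_left) (use assms in \<open>auto simp: in_keys_iff\<close>)

lemma mp_subst_diff:
  assumes "\<And>a b. \<phi> (a - b) = \<phi> a - \<phi> b"
  shows "mp_subst \<phi> x (g - h) = mp_subst \<phi> x g - mp_subst \<phi> x h"
proof -
  have 0: "\<phi> 0 = 0" using assms[of 0 0] by simp
  \<comment> \<open>Cancellation can shrink the support of \<open>g - h\<close>, so all three sums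
    are taken over the union of the two supports.\<close>
  let ?S = "Poly_Mapping.keys g \<union> Poly_Mapping.keys h"
  have "Poly_Mapping.keys (g - h) \<subseteq> ?S" by (auto simp: in_keys_iff lookup_minus)
  thus ?thesis
    by (subst (1 2 3) mp_subst_superset[where S = ?S])
       (use 0 in \<open>auto simp: lookup_minus assms algebra_simps sum_subtractf\<close>)
qed

lemma mp_subst_single:
  assumes "\<phi> 0 = 0"
  shows "mp_subst \<phi> x (Poly_Mapping.single m c) = \<phi> c * (\<Prod>i\<in>UNIV. x i ^ Poly_Mapping.lookup m i)"
  by (subst mp_subst_superset[where S = "{m}"]) (use assms in \<open>auto simp: in_keys_iff lookup_single when_def\<close>)

lemma mp_partial_superset:
  assumes "finite S" "Poly_Mapping.keys g \<subseteq> S"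
  shows "mp_partial i g = (\<Sum>m\<in>S. Poly_Mapping.single (m - Poly_Mapping.single i 1)
    (of_nat (Poly_Mapping.lookup m i) * Poly_Mapping.lookup g m))"
  unfolding mp_partial_def
  by (rule sum.mono_neutral_left) (use assms in \<open>auto simp: in_keys_iff\<close>)

lemma mp_partial_diff: "mp_partial i (g - h) = mp_partial i g - mp_partial i h"
proof -
  let ?S = "Poly_Mapping.keys g \<union> Poly_Mapping.keys h"
  have "Poly_Mapping.keys (g - h) \<subseteq> ?S" by (auto simp: in_keys_iff lookup_minus)
  thus ?thesis
    by (subst (1 2 3) mp_partial_superset[where S = ?S])
       (auto simp: lookup_minus single_diff algebra_simps sum_subtractf)
qed

text \<open>If the variable does not occur in \<open>m\<close>, truncated subtraction leaves
  \<open>m\<close> unchanged, but then the coefficient is 0.\<close>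

lemma mp_partial_single:
  "mp_partial i (Poly_Mapping.single m c) =
    Poly_Mapping.single (m - Poly_Mapping.single i 1) (of_nat (Poly_Mapping.lookup m i) * c)"
  by (subst mp_partial_superset[where S = "{m}"]) (auto simp: in_keys_iff lookup_single when_def)

lemma X_power: "X i ^ n = Poly_Mapping.single (Poly_Mapping.single i n) 1"
proof (induction n)
  case (Suc n)
  have "Poly_Mapping.single i 1 + Poly_Mapping.single i n = Poly_Mapping.single i (Suc n)"
    by (simp flip: single_add)
  with Suc show ?case by (simp add: X_def mult_single)
qed simp

section \<open>The cubic form of the Cayley surface\<close>

lemma cayley_f_eq:
  "cayley_f =
    Poly_Mapping.single (Poly_Mapping.single 0 1 + Poly_Mapping.single 1 1 + Poly_Mapping.single 2 1) 1
    - Poly_Mapping.single (Poly_Mapping.single 1 3) 1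
    - Poly_Mapping.single (Poly_Mapping.single 0 2 + Poly_Mapping.single 3 1) 1"
  unfolding cayley_f_def X_power by (simp add: X_def mult_single del: single_numeral)

lemma mp_subst_cayley_f:
  assumes "\<And>a b. \<phi> (a - b) = \<phi> a - \<phi> b" "\<phi> 1 = 1"
  shows "mp_subst \<phi> x cayley_f = x 0 * x 1 * x 2 - x 1 ^ 3 - x 0 ^ 2 * x 3"
proof -
  have 0: "\<phi> 0 = 0" using assms(1)[of 0 0] by simp
  show ?thesis
    unfolding cayley_f_eq
    by (simp add: mp_subst_diff[of \<phi>, OF assms(1)] mp_subst_single[of \<phi>, OF 0] assms(2)
        prod_4_from_0 lookup_add lookup_single when_def power2_eq_square del: single_numeral)
qed

lemma mp_eval_cayley_f:
  "mp_eval cayley_f x = x $ 0 * x $ 1 * x $ 2 - (x $ 1) ^ 3 - (x $ 0)\<^sup>2 * x $ 3"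
  unfolding mp_eval_def by (subst mp_subst_cayley_f) simp_all

text \<open>This one derivative certifies that a point of the surface off the plane
  \<open>\<omega>\<close> is simple, in every characteristic.\<close>

lemma mp_eval_partial_3_cayley_f: "mp_eval (mp_partial 3 cayley_f) x = - (x $ 0)\<^sup>2"
proof -
  have "(Poly_Mapping.single 0 2 + Poly_Mapping.single 3 1 :: 4 \<Rightarrow>\<^sub>0 nat) - Poly_Mapping.single 3 1 =
    Poly_Mapping.single 0 2" by simp
  thus ?thesis
    unfolding mp_eval_def cayley_f_eq
    by (simp add: mp_partial_diff mp_partial_single mp_subst_diff[of "\<lambda>c. c"] mp_subst_single[of "\<lambda>c. c"]
        prod_4_from_0 lookup_add lookup_single when_def power2_eq_square single_uminus[symmetric]
        del: single_numeral)
qed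

lemma mp_eval_X: "mp_eval (X i) x = x $ i"
proof -
  have "(\<Prod>j\<in>UNIV. (x $ j) ^ Poly_Mapping.lookup (Poly_Mapping.single i 1) j) =
    (\<Prod>j\<in>UNIV. if j = i then x $ i else 1)"
    by (rule prod.cong) (auto simp: lookup_single when_def)
  thus ?thesis by (simp add: mp_eval_def X_def mp_subst_single[of "\<lambda>c. c"])
qed

section \<open>Forms vanishing on the Pluecker coordinates of the tangents\<close>

lemma mp_eval_vec6:
  "mp_eval h (vec6 a b c d e f) = (\<Sum>m\<in>Poly_Mapping.keys h. Poly_Mapping.lookup h m *
    (a ^ Poly_Mapping.lookup m 0 * b ^ Poly_Mapping.lookup m 1 * c ^ Poly_Mapping.lookup m 2 *
     d ^ Poly_Mapping.lookup m 3 * e ^ Poly_Mapping.lookup m 4 * f ^ Poly_Mapping.lookup m 5))"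
  by (simp add: mp_eval_def mp_subst_def prod_6 mult.assoc)

lemma poly_eq_0_if_infinite:
  fixes p :: "'a::field poly"
  assumes "infinite (UNIV :: 'a set)" "\<And>x. poly p x = 0"
  shows "p = 0"
  using poly_roots_finite[of p] assms by auto

lemma form_vanishing:
  fixes h :: "(6, 'a::field) mpol"
  assumes inf: "infinite (UNIV :: 'a set)" and "is_form h"
    and van: "\<And>t v. mp_eval h (vec6 1 (3 * t) (v * t\<^sup>2) ((3 - v) * t\<^sup>2) (t ^ 3)
      ((v\<^sup>2 - 3 * v + 3) * t ^ 4)) = 0"
  shows "mp_eval h (vec6 0 0 0 0 a b) = 0"
proof -
  obtain d where d: "\<And>m. m \<in> Poly_Mapping.keys h \<Longrightarrow> (\<Sum>i\<in>UNIV. Poly_Mapping.lookup m i) = d"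
    using \<open>is_form h\<close> by (auto simp: is_form_def)
  define e :: "(6 \<Rightarrow>\<^sub>0 nat) \<Rightarrow> 6 \<Rightarrow> nat" where "e = Poly_Mapping.lookup"
  define c where "c = Poly_Mapping.lookup h"
  define M where "M = Poly_Mapping.keys h"
  have M: "finite M" by (simp add: M_def)
  have deg: "e m 0 + e m 1 + e m 2 + e m 3 + e m 4 + e m 5 = d" if "m \<in> M" for m
    using d[of m] that by (simp add: e_def M_def sum_6)
  \<comment> \<open>\<open>w m\<close> is the exponent of t, and \<open>B m\<close> below the
    coefficient as a polynomial in v, when the monomial \<open>m\<close> of \<open>h\<close> is
    evaluated at the tangent.\<close>
  define w where "w m = e m 1 + 2 * e m 2 + 2 * e m 3 + 3 * e m 4 + 4 * e m 5" for m
  define N :: "'a poly" where "N = [:3, -3, 1:]"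
  have N: "poly N v = v\<^sup>2 - 3 * v + 3" for v
    by (simp add: N_def power2_eq_square algebra_simps)
  define B where "B m = smult (c m * 3 ^ e m 1) ([:0, 1:] ^ e m 2 * [:3, -1:] ^ e m 3 * N ^ e m 5)" for m
  \<comment> \<open>Infinitude of the field is used twice: for fixed v the values form a polynomial
    \<open>A\<close> in t with every t a root, so each coefficient is 0; each coefficient is a
    polynomial in v with every v a root.\<close>
  have B_sum: "(\<Sum>m\<in>{m\<in>M. w m = j}. B m) = 0" for j
  proof (rule poly_eq_0_if_infinite[OF inf])
    fix v
    define A where "A = (\<Sum>m\<in>M. monom (poly (B m) v) (w m))"
    have "A = 0"
    proof (rule poly_eq_0_if_infinite[OF inf])
      fix t
      have "poly A t = mp_eval h (vec6 1 (3 * t) (v * t\<^sup>2) ((3 - v) * t\<^sup>2) (t ^ 3)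
        ((v\<^sup>2 - 3 * v + 3) * t ^ 4))"
        unfolding A_def mp_eval_vec6 poly_sum M_def[symmetric] c_def[symmetric] e_def[symmetric]
        by (rule sum.cong) (simp_all add: poly_monom B_def w_def N poly_power power_mult_distrib
            power_mult power_add ac_simps)
      thus "poly A t = 0" by (simp add: van)
    qed
    hence "0 = coeff A j" by simp
    also have "\<dots> = (\<Sum>m\<in>M. if w m = j then poly (B m) v else 0)"
      by (simp add: A_def coeff_sum)
    also have "\<dots> = poly (\<Sum>m\<in>{m\<in>M. w m = j}. B m) v"
      unfolding poly_sum by (rule sum.inter_filter[OF M, symmetric])
    finally show "poly (\<Sum>m\<in>{m\<in>M. w m = j}. B m) v = 0" by simp
  qed
  have not_pure: "\<not> (e m 0 = 0 \<and> e m 1 = 0 \<and> e m 2 = 0 \<and> e m 3 = 0)" if m: "m \<in> M" for m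
  proof
    assume pure: "e m 0 = 0 \<and> e m 1 = 0 \<and> e m 2 = 0 \<and> e m 3 = 0"
    define k where "k = e m 5"
    have k: "e m 4 + k = d" using deg[OF m] pure by (simp add: k_def)
    have wm: "w m = 3 * d + k" using pure k by (simp add: w_def k_def)
    let ?S = "{m\<in>M. w m = 3 * d + k}"
    have "N ^ Suc k dvd B m'" if "m' \<in> ?S - {m}" for m'
    proof -
      have m': "m' \<in> M" "w m' = 3 * d + k" "m' \<noteq> m" using that by auto
      have "k < e m' 5"
      proof (rule ccontr)
        assume *: "\<not> k < e m' 5"
        \<comment> \<open>By the degree condition, \<open>w m'\<close> = 3d + e5 - 3 e0 - 2 e1 - e2
          - e3, with ei for \<open>e m' i\<close>. If e5 is at most \<open>k\<close>, the value 3d +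
          k forces e0 to e3 to be 0 and e5 = \<open>k\<close>.\<close>
        have z: "e m' 0 = 0" "e m' 1 = 0" "e m' 2 = 0" "e m' 3 = 0" "e m' 5 = k"
          using * m'(2) deg[OF m'(1)] unfolding w_def by linarith+
        moreover from this have "e m' 4 = e m 4" using deg[OF m'(1)] k by simp
        ultimately have "\<forall>i. e m' i = e m i"
          using pure unfolding forall_6_from_0 by (simp add: k_def)
        hence "m' = m" unfolding e_def by (intro poly_mapping_eqI) simp
        with m'(3) show False ..
      qed
      thus ?thesis unfolding B_def by (intro dvd_smult dvd_mult le_imp_power_dvd) simp
    qed
    hence "N ^ Suc k dvd (\<Sum>m'\<in>?S - {m}. B m')" by (intro dvd_sum)
    moreover have "B m + (\<Sum>m'\<in>?S - {m}. B m') = 0"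
      using B_sum[of "3 * d + k"] m wm M by (subst (asm) sum.remove[where x = m]) auto
    ultimately have "N ^ Suc k dvd B m"
      using dvd_add_left_iff[of "N ^ Suc k" "\<Sum>m'\<in>?S - {m}. B m'" "B m"] by simp
    moreover have "B m = N ^ k * [:c m:]" using pure by (simp add: B_def k_def)
    ultimately have "N ^ k * N dvd N ^ k * [:c m:]" by (simp add: mult.commute)
    moreover have "N ^ k \<noteq> 0" by (simp add: N_def)
    ultimately have "N dvd [:c m:]" by (metis dvd_mult_cancel_left)
    \<comment> \<open>\<open>N\<close> is monic of degree 2 in every characteristic, so it divides
      no nonzero constant.\<close>
    hence "c m = 0" using dvd_imp_degree_le[of N "[:c m:]"] by (auto simp: N_def)
    thus False using m by (simp add: M_def c_def in_keys_iff)
  qed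
  \<comment> \<open>Every monomial of \<open>h\<close> has a positive power of one of the first four
    coordinates, hence a factor 0.\<close>
  show ?thesis
    unfolding mp_eval_vec6 M_def[symmetric] e_def[symmetric]
    by (rule sum.neutral) (use not_pure in auto)
qed

section \<open>Lines, Pluecker vectors and the two families of lines\<close>

lemma lin_indepD:
  assumes "lin_indep p q"
  shows "p \<noteq> 0" "q \<noteq> c *s p"
proof -
  have i: "vec.independent {p, q}" and ne: "p \<noteq> q" using assms by (auto simp: lin_indep_def)
  show "p \<noteq> 0" using i vec.dependent_zero[of "{p, q}"] by auto
  have "q \<notin> vec.span {p}"
    using i ne vec.independent_insert[of q "{p}"] by (auto simp: insert_commute)
  thus "q \<noteq> c *s p" by (auto simp: vec.span_singleton)
qed

lemma lin_indepI:
  assumes "p \<noteq> 0" "\<And>c. q \<noteq> c *s p"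
  shows "lin_indep p q"
proof -
  have "p \<noteq> q" using assms(2)[of 1] by auto
  moreover have "q \<notin> vec.span {p}" using assms(2) by (auto simp: vec.span_singleton)
  ultimately show ?thesis
    using assms(1) vec.independent_insert[of q "{p}"]
    by (auto simp: lin_indep_def insert_commute)
qed

text \<open>If all 2 by 2 minors vanish, a nonzero coordinate \<open>p $ i\<close> gives the ratio
  \<open>q $ i / p $ i\<close> that makes \<open>q\<close> a multiple of \<open>p\<close>.\<close>

lemma pluecker_nonzero:
  fixes p q :: "'a::field ^ 4"
  assumes "lin_indep p q"
  shows "pluecker p q \<noteq> 0"
proof
  assume 0: "pluecker p q = 0"
  have y: "\<forall>i j. p $ i * q $ j = p $ j * q $ i"
    using 0 unfolding vec_eq_iff forall_6_from_0 forall_4_from_0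
    by (auto simp: pluecker_def Let_def)
  obtain i where i: "p $ i \<noteq> 0" using lin_indepD(1)[OF assms] by (auto simp: vec_eq_iff)
  have "q $ j = ((q $ i / p $ i) *s p) $ j" for j
    using y[rule_format, of i j] i by (simp add: field_simps)
  hence "q = (q $ i / p $ i) *s p" unfolding vec_eq_iff by blast
  thus False using lin_indepD(2)[OF assms] by blast
qed

text \<open>For a direction (0, 1, q2, q3) the coefficient of T^2 in f(p + Tq) is q2 - 3 u1, and
  once q2 = 3 u1 the coefficient of T is u2 - q3. The choice of \<open>q\<close> makes both vanish
  and leaves -T^3.\<close>

lemma proper_osculating_tangent_at:
  fixes u1 u2 :: "'a::field"
  defines "p \<equiv> vec4 1 u1 u2 (u1 * u2 - u1 ^ 3)" and "q \<equiv> vec4 0 1 (3 * u1) u2"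
  shows "lin_indep p q" "join p q \<in> proper_osculating_tangents"
proof -
  have p0: "p \<noteq> 0" unfolding p_def by (metis vec4_nth(1) zero_index zero_neq_one)
  have pq0: "p $ 0 = 1" "q $ 0 = 0" "q $ 1 = 1" by (simp_all add: p_def q_def)
  have "q \<noteq> c *s p" for c
  proof
    assume "q = c *s p"
    hence "q $ 0 = c * p $ 0" "q $ 1 = c * p $ 1" by simp_all
    thus False using pq0 by simp
  qed
  with p0 show ind: "lin_indep p q" by (rule lin_indepI)
  have "vec.span {p} \<in> simple_points"
  proof -
    have pt: "vec.span {p} \<in> points" using p0 by (auto simp: points_def)
    moreover have "mp_eval cayley_f x = 0" if "x \<in> vec.span {p}" for x
      using that by (auto simp: vec.span_singleton mp_eval_cayley_f p_def
          power2_eq_square power3_eq_cube algebra_simps)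
    moreover have "mp_eval (mp_partial 3 cayley_f) p \<noteq> 0"
      by (simp add: mp_eval_partial_3_cayley_f pq0)
    ultimately show ?thesis
      using p0 vec.span_base[of p "{p}"] by (auto simp: simple_points_def cayley_surface_def \<V>_def)
  qed
  moreover have "osculating_at (join p q) (vec.span {p})"
  proof -
    have "mp_subst (\<lambda>c. [:c:]) (\<lambda>i. [:p $ i, q $ i:]) cayley_f = [:0, 1:] ^ 3 * [:-1:]"
      by (subst mp_subst_cayley_f)
         (simp_all add: p_def q_def one_pCons power2_eq_square power3_eq_cube algebra_simps)
    hence "[:0, 1:] ^ 3 dvd mp_subst (\<lambda>c. [:c:]) (\<lambda>i. [:p $ i, q $ i:]) cayley_f"
      by (simp only: dvd_triv_left)
    with ind show ?thesis unfolding osculating_at_def by blast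
  qed
  \<comment> \<open>The Pluecker coordinate with index 01 separates the lines: it is 0 on every
    generator and 1 for \<open>p\<close> and \<open>q\<close>.\<close>
  moreover have "join p q \<notin> generators"
  proof
    assume "join p q \<in> generators"
    then obtain s0 s1 where g: "join p q = join (vec4 (s0\<^sup>2) (s0 * s1) (s1\<^sup>2) 0) (vec4 0 0 s0 s1)"
      by (auto simp: generators_def)
    let ?g1 = "vec4 (s0\<^sup>2) (s0 * s1) (s1\<^sup>2) 0" and ?g2 = "vec4 0 0 s0 s1"
    have "vec.span {p, q} = vec.span {?g1, ?g2}" by (simp add: span_join g)
    hence "pluecker p q \<in> vec.span {pluecker ?g1 ?g2}"
      by (intro pluecker_in_span) (auto intro: vec.span_base)
    then obtain c where "pluecker p q = c *s pluecker ?g1 ?g2" by (auto simp: vec.span_singleton)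
    hence "pluecker p q $ 0 = c * pluecker ?g1 ?g2 $ 0" by simp
    thus False by (simp add: pluecker_def Let_def pq0)
  qed
  ultimately show "join p q \<in> proper_osculating_tangents"
    by (auto simp: proper_osculating_tangents_def)
qed

text \<open>The factor \<open>c\<close> runs through all nonzero representatives of the point, as in
  the definition of \<open>\<V>\<close>.\<close>

lemma klein_in_variety_iff:
  fixes p q :: "'a::field ^ 4"
  assumes "lin_indep p q"
  shows "klein (join p q) \<in> \<V> {h} \<longleftrightarrow> (\<forall>c. c \<noteq> 0 \<longrightarrow> mp_eval h (c *s pluecker p q) = 0)"
  using pluecker_nonzero[OF assms]
  by (auto simp: klein_join[OF assms] \<V>_def points_def vec.span_singleton)

text \<open>Lying in \<open>\<omega>\<close> kills the three Pluecker coordinates that involve index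
  0; passing through \<open>Z\<close> kills the one with index 12.\<close>

lemma pencil_Z_omegaE:
  fixes t :: "('a::field ^ 4) set set"
  assumes "t \<in> pencil Z \<omega>"
  obtains p q a b where "lin_indep p q" "t = join p q" "pluecker p q = vec6 0 0 0 0 a b"
proof -
  obtain p q where ind: "lin_indep p q" and t: "t = join p q" "t \<subseteq> \<omega>" "Z \<in> t"
    using assms by (auto simp: pencil_def lines_def)
  have om: "x $ 0 = 0" if "x \<in> vec.span {p, q}" for x
  proof (cases "x = 0")
    case False
    have "vec.span {x} \<subseteq> vec.span {p, q}"
      using that by (simp add: vec.span_minimal vec.subspace_span)
    hence "vec.span {x} \<in> \<omega>" using False t by (auto simp: join_def points_def)
    thus ?thesis using False vec.span_base[of x "{x}"] by (auto simp: \<omega>_def \<V>_def mp_eval_X)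
  qed simp
  have p0: "p $ 0 = 0" and q0: "q $ 0 = 0" by (simp_all add: om vec.span_base)
  have "vec4 0 0 0 1 \<in> vec.span {p, q}"
    using t vec.span_base[of "vec4 0 0 0 1" "{vec4 0 0 0 1}"] by (auto simp: join_def Z_def)
  then obtain \<alpha> where "vec4 0 0 0 1 - \<alpha> *s p \<in> vec.span {q}" by (auto simp: vec.span_insert)
  then obtain \<beta> where "vec4 0 0 0 1 - \<alpha> *s p = \<beta> *s q" by (auto simp: vec.span_singleton)
  hence z: "vec4 0 0 0 1 = \<alpha> *s p + \<beta> *s q" by (simp add: algebra_simps)
  have z1: "0 = \<alpha> * p $ 1 + \<beta> * q $ 1" and z2: "0 = \<alpha> * p $ 2 + \<beta> * q $ 2"
    and z3: "1 = \<alpha> * p $ 3 + \<beta> * q $ 3"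
    using arg_cong[OF z, of "\<lambda>x. x $ 1"] arg_cong[OF z, of "\<lambda>x. x $ 2"]
      arg_cong[OF z, of "\<lambda>x. x $ 3"] by simp_all
  \<comment> \<open>The relations \<open>z1\<close> and \<open>z2\<close> are linear in \<alpha> and
    \<beta> with this determinant, and \<open>z3\<close> excludes \<alpha> = \<beta> = 0.\<close>
  have "\<alpha> * (p $ 1 * q $ 2 - p $ 2 * q $ 1) = 0" "\<beta> * (p $ 1 * q $ 2 - p $ 2 * q $ 1) = 0"
    using z1 z2 by algebra+
  hence "p $ 1 * q $ 2 - p $ 2 * q $ 1 = 0" using z3 by auto
  hence "pluecker p q =
    vec6 0 0 0 0 (p $ 1 * q $ 3 - p $ 3 * q $ 1) (p $ 2 * q $ 3 - p $ 3 * q $ 2)"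
    by (simp add: pluecker_def Let_def p0 q0)
  with ind t(1) show ?thesis by (rule that)
qed

theorem theorem4p5:
  fixes h :: "(6, 'a::field) mpol"
  assumes "infinite (UNIV :: 'a set)" and "CHAR('a) \<noteq> 3"
    and "is_form h"
    and "klein ` osculating_family \<subseteq> \<V> {h}"
  shows "klein ` pencil Z \<omega> \<subseteq> \<V> {h}"
proof -
  have "mp_eval h (vec6 1 (3 * t) (v * t\<^sup>2) ((3 - v) * t\<^sup>2) (t ^ 3) ((v\<^sup>2 - 3 * v + 3) * t ^ 4)) = 0"
    (is "mp_eval h ?y = 0") for t v
  proof -
    \<comment> \<open>Taking u1 = t and u2 = v t^2 makes each Pluecker coordinate a power of t times
      a polynomial in v.\<close>
    define p where "p = vec4 1 t (v * t\<^sup>2) (t * (v * t\<^sup>2) - t ^ 3)"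
    define q where "q = vec4 0 1 (3 * t) (v * t\<^sup>2)"
    have ind: "lin_indep p q" and "join p q \<in> proper_osculating_tangents"
      unfolding p_def q_def by (rule proper_osculating_tangent_at)+
    hence "klein (join p q) \<in> \<V> {h}" using assms(4) by (auto simp: osculating_family_def)
    hence "mp_eval h (1 *s pluecker p q) = 0" using klein_in_variety_iff[OF ind] by (metis zero_neq_one)
    moreover have "1 *s pluecker p q = ?y"
      unfolding vec_eq_iff forall_6_from_0
      by (simp add: pluecker_def Let_def p_def q_def eval_nat_numeral algebra_simps)
    ultimately show ?thesis by simp
  qed
  hence h0: "mp_eval h (vec6 0 0 0 0 a b) = 0" for a b
    using form_vanishing assms(1,3) by blast
  show ?thesis
  proof
    fix P :: "('a ^ 6) set" assume "P \<in> klein ` pencil Z \<omega>"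
    then obtain t where t: "t \<in> pencil Z \<omega>" "P = klein t" by auto
    from t(1) obtain p q a b where pq: "lin_indep p q" "t = join p q" "pluecker p q = vec6 0 0 0 0 a b"
      by (rule pencil_Z_omegaE)
    have "c *s vec6 0 0 0 0 a b = vec6 0 0 0 0 (c * a) (c * b)" for c
      unfolding vec_eq_iff forall_6_from_0 by simp
    thus "P \<in> \<V> {h}" by (simp add: t(2) pq(2,3) klein_in_variety_iff[OF pq(1)] h0)
  qed
qed

end
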